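(* Let $m\ge3$ and let $(A,B,c)$ be a constant-free triplet over $\mathbb{C}$ (i.e. $a_{i,1}=b_{i,1}=0$ for all $i$) with $a_{1,2}=b_{1,2}=1$, $b_{2,2}=0$ and $a_{2,3}=a_{3,4}=b_{2,3}=b_{3,4}=1$, and let $p$ be its associated polynomial. For $\alpha,\beta\in\mathbb{C}$ put $$s_1=\alpha(b_{3,2}-a_{3,2})-\alpha^2,\qquad s_2=\beta(b_{3,3}-a_{3,3})-\beta^2,$$ and let $(\hat A,\hat B,\hat c)$ be the triplet obtained from $(A,B,c)$ by setting $$\hat a_{3,2}=a_{3,2}+\alpha,\quad \hat b_{3,2}=b_{3,2}-\alpha,\quad \hat a_{3,3}=a_{3,3}+\beta,\quad \hat b_{3,3}=b_{3,3}-\beta,$$ $$\hat a_{i,3}=a_{i,3}-a_{i,5}s_1,\quad \hat a_{i,4}=a_{i,4}-a_{i,5}s_2,\quad \hat b_{i,3}=b_{i,3}-b_{i,5}s_1,\quad \hat b_{i,4}=b_{i,4}-b_{i,5}s_2\qquad(i=4,\dots,m),$$ $$\hat c_3=c_3-c_5s_1,\qquad \hat c_4=c_4-c_5s_2,$$ with all other entries of $\hat A,\hat B,\hat c$ equal to the corresponding entries of $A,B,c$. Then the polynomial $\hat p$ associated with $(\hat A,\hat B,\hat c)$ satisfies $\hat p=p$ for any $\alpha,\beta$ satisfying $$\alpha(b_{3,3}-a_{3,3})+\beta(b_{3,2}-a_{3,2})-2\alpha\beta-s_2\,a_{2,2}=0 .$$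
   Context: Evaluation scheme. A triplet $(A,B,c)$ (for $m$ multiplications) consists of scalars $a_{i,j},b_{i,j}\in\mathbb{C}$ for $1\le i\le m$, $1\le j\le i+1$ (the entries of $m\times(m+1)$ lower Hessenberg matrices $A,B$; entries with $j>i+1$ are zero), and a vector $c=(c_1,\dots,c_{m+2})\in\mathbb{C}^{m+2}$. The associated polynomial is $p=\sum_{j=1}^{m+2}c_jQ_j\in\mathbb{C}[x]$, where $Q_1=1$, $Q_2=x$, and for $i=1,\dots,m$ $$Q_{i+2}=\Big(\sum_{j=1}^{i+1}a_{i,j}Q_j\Big)\Big(\sum_{j=1}^{i+1}b_{i,j}Q_j\Big).$$ *)

theory Defs
  imports Complex_Main "HOL-Computational_Algebra.Polynomial"
begin

text \<open>
  Matrices and vectors are functions on indices starting at 1. The predicate \<open>triplet m\<close> makes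
  them vanish outside the index range \<open>1 \<le> i \<le> m\<close>, \<open>1 \<le> j \<le> i + 1\<close> of the entries of an
  \<open>m \<times> (m + 1)\<close> lower Hessenberg matrix (resp. outside \<open>1 \<le> j \<le> m + 2\<close>), so that the functions
  satisfying it correspond one-to-one to the actual triplets.
\<close>

definition lower_hessenberg :: "nat \<Rightarrow> (nat \<Rightarrow> nat \<Rightarrow> complex) \<Rightarrow> bool" where
  "lower_hessenberg m A \<longleftrightarrow>
     (\<forall>i j. \<not> (1 \<le> i \<and> i \<le> m \<and> 1 \<le> j \<and> j \<le> i + 1) \<longrightarrow> A i j = 0)"

definition triplet ::
  "nat \<Rightarrow> (nat \<Rightarrow> nat \<Rightarrow> complex) \<Rightarrow> (nat \<Rightarrow> nat \<Rightarrow> complex) \<Rightarrow> (nat \<Rightarrow> complex) \<Rightarrow> bool" where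
  "triplet m A B c \<longleftrightarrow> lower_hessenberg m A \<and> lower_hessenberg m B \<and>
     (\<forall>j. \<not> (1 \<le> j \<and> j \<le> m + 2) \<longrightarrow> c j = 0)"

definition constant_free ::
  "nat \<Rightarrow> (nat \<Rightarrow> nat \<Rightarrow> complex) \<Rightarrow> (nat \<Rightarrow> nat \<Rightarrow> complex) \<Rightarrow> bool" where
  "constant_free m A B \<longleftrightarrow> (\<forall>i\<in>{1..m}. A i 1 = 0 \<and> B i 1 = 0)"

text \<open>The value at index 0 is a dummy that is never used; the recursion in its usual indexing
  is \<open>Q_rec\<close> below.\<close>

fun Q :: "(nat \<Rightarrow> nat \<Rightarrow> complex) \<Rightarrow> (nat \<Rightarrow> nat \<Rightarrow> complex) \<Rightarrow> nat \<Rightarrow> complex poly" where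
  "Q A B 0 = 0"
| "Q A B (Suc 0) = 1"
| "Q A B (Suc (Suc 0)) = [:0, 1:]"
| "Q A B (Suc (Suc (Suc n))) =
     (\<Sum>j = 1..n + 2. smult (A (n + 1) j) (Q A B j)) *
     (\<Sum>j = 1..n + 2. smult (B (n + 1) j) (Q A B j))"

declare Q.simps(4) [simp del]

lemma Q_rec:
  assumes "1 \<le> i"
  shows "Q A B (i + 2) =
     (\<Sum>j = 1..i + 1. smult (A i j) (Q A B j)) * (\<Sum>j = 1..i + 1. smult (B i j) (Q A B j))"
proof -
  obtain n where "i = Suc n" using assms by (cases i) auto
  then show ?thesis using Q.simps(4)[of A B n] by simp
qed

definition assoc_poly ::
  "nat \<Rightarrow> (nat \<Rightarrow> nat \<Rightarrow> complex) \<Rightarrow> (nat \<Rightarrow> nat \<Rightarrow> complex) \<Rightarrow> (nat \<Rightarrow> complex) \<Rightarrow> complex poly" where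
  "assoc_poly m A B c = (\<Sum>j = 1..m + 2. smult (c j) (Q A B j))"

definition s1 :: "(nat \<Rightarrow> nat \<Rightarrow> complex) \<Rightarrow> (nat \<Rightarrow> nat \<Rightarrow> complex) \<Rightarrow> complex \<Rightarrow> complex" where
  "s1 A B \<alpha> = \<alpha> * (B 3 2 - A 3 2) - \<alpha>\<^sup>2"

definition s2 :: "(nat \<Rightarrow> nat \<Rightarrow> complex) \<Rightarrow> (nat \<Rightarrow> nat \<Rightarrow> complex) \<Rightarrow> complex \<Rightarrow> complex" where
  "s2 A B \<beta> = \<beta> * (B 3 3 - A 3 3) - \<beta>\<^sup>2"

definition hat_A ::
  "nat \<Rightarrow> (nat \<Rightarrow> nat \<Rightarrow> complex) \<Rightarrow> (nat \<Rightarrow> nat \<Rightarrow> complex) \<Rightarrow> complex \<Rightarrow> complex \<Rightarrow>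
   nat \<Rightarrow> nat \<Rightarrow> complex" where
  "hat_A m A B \<alpha> \<beta> i j =
     (if i = 3 \<and> j = 2 then A 3 2 + \<alpha>
      else if i = 3 \<and> j = 3 then A 3 3 + \<beta>
      else if 4 \<le> i \<and> i \<le> m \<and> j = 3 then A i 3 - A i 5 * s1 A B \<alpha>
      else if 4 \<le> i \<and> i \<le> m \<and> j = 4 then A i 4 - A i 5 * s2 A B \<beta>
      else A i j)"

definition hat_B ::
  "nat \<Rightarrow> (nat \<Rightarrow> nat \<Rightarrow> complex) \<Rightarrow> (nat \<Rightarrow> nat \<Rightarrow> complex) \<Rightarrow> complex \<Rightarrow> complex \<Rightarrow>
   nat \<Rightarrow> nat \<Rightarrow> complex" where
  "hat_B m A B \<alpha> \<beta> i j =
     (if i = 3 \<and> j = 2 then B 3 2 - \<alpha>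
      else if i = 3 \<and> j = 3 then B 3 3 - \<beta>
      else if 4 \<le> i \<and> i \<le> m \<and> j = 3 then B i 3 - B i 5 * s1 A B \<alpha>
      else if 4 \<le> i \<and> i \<le> m \<and> j = 4 then B i 4 - B i 5 * s2 A B \<beta>
      else B i j)"

definition hat_c ::
  "(nat \<Rightarrow> nat \<Rightarrow> complex) \<Rightarrow> (nat \<Rightarrow> nat \<Rightarrow> complex) \<Rightarrow> (nat \<Rightarrow> complex) \<Rightarrow>
   complex \<Rightarrow> complex \<Rightarrow> nat \<Rightarrow> complex" where
  "hat_c A B c \<alpha> \<beta> j =
     (if j = 3 then c 3 - c 5 * s1 A B \<alpha>
      else if j = 4 then c 4 - c 5 * s2 A B \<beta>
      else c j)"

lemma triplet_hat:
  assumes "3 \<le> m" and "triplet m A B c"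
  shows "triplet m (hat_A m A B \<alpha> \<beta>) (hat_B m A B \<alpha> \<beta>) (hat_c A B c \<alpha> \<beta>)"
  using assms by (auto simp: triplet_def lower_hessenberg_def hat_A_def hat_B_def hat_c_def)

end

theory Submission
  imports Defs
begin

text \<open>
  The perturbation by \<open>\<alpha>\<close>, \<open>\<beta>\<close> leaves \<open>Q\<^sub>3\<close> and \<open>Q\<^sub>4 = Q\<^sub>3 (a\<^sub>2\<^sub>2 x + Q\<^sub>3)\<close> unchanged and alters the
  product \<open>Q\<^sub>5\<close> only in degrees 2, 3 and 4. The condition on \<open>\<alpha>\<close>, \<open>\<beta>\<close> makes the
  coefficients of \<open>x\<^sup>3\<close> and \<open>x\<^sup>4\<close> fit a multiple of \<open>Q\<^sub>4\<close>, so that \<open>Q\<^sub>5\<close> changes by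
  \<open>s\<^sub>1 Q\<^sub>3 + s\<^sub>2 Q\<^sub>4\<close>. The corrected weights of \<open>Q\<^sub>3\<close> and \<open>Q\<^sub>4\<close> cancel this in every later
  linear combination, hence all \<open>Q\<^sub>j\<close> with \<open>j \<noteq> 5\<close> and the final polynomial are unchanged.
\<close>

text \<open>The extra multiples \<open>w 5 * s\<close> of \<open>q 3\<close> and
  \<open>w 5 * t\<close> of \<open>q 4\<close> brought in by \<open>q' 5\<close> are exactly what
  the new weights subtract. Applied to the rows from the fourth on in both matrices, and to the
  output vector.\<close>

lemma sum_weights_compensate:
  fixes q q' :: "nat \<Rightarrow> complex poly" and w w' :: "nat \<Rightarrow> complex"
  assumes n: "5 \<le> n"
    and q: "\<And>j. \<lbrakk>1 \<le> j; j \<le> n; j \<noteq> 5\<rbrakk> \<Longrightarrow> q' j = q j"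
    and q5: "q' 5 = q 5 + smult s (q 3) + smult t (q 4)"
    and w: "\<And>j. \<lbrakk>j \<noteq> 3; j \<noteq> 4\<rbrakk> \<Longrightarrow> w' j = w j"
    and w3: "w' 3 = w 3 - w 5 * s"
    and w4: "w' 4 = w 4 - w 5 * t"
  shows "(\<Sum>j = 1..n. smult (w' j) (q' j)) = (\<Sum>j = 1..n. smult (w j) (q j))"
proof -
  let ?I = "{3, 4, 5} :: nat set"
  have split: "(\<Sum>j = 1..n. f j) = (\<Sum>j \<in> {1..n} - ?I. f j) + (f 3 + f 4 + f 5)"
    for f :: "nat \<Rightarrow> complex poly"
    using n sum.subset_diff[of ?I "{1..n}" f] by (auto simp: add.assoc)
  have "(\<Sum>j \<in> {1..n} - ?I. smult (w' j) (q' j)) = (\<Sum>j \<in> {1..n} - ?I. smult (w j) (q j))"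
    by (rule sum.cong) (auto simp: q w)
  moreover have "smult (w' 3) (q' 3) + smult (w' 4) (q' 4) + smult (w' 5) (q' 5)
      = smult (w 3) (q 3) + smult (w 4) (q 4) + smult (w 5) (q 5)"
    using n by (simp add: q q5 w w3 w4 smult_add_right smult_diff_left)
  ultimately show ?thesis
    unfolding split by presburger
qed

lemma Q_3:
  assumes "A 1 1 = 0" "B 1 1 = 0" "A 1 2 = 1" "B 1 2 = 1"
  shows "Q A B 3 = [:0, 0, 1:]"
  using Q_rec[of 1 A B] assms by (simp add: numeral_eq_Suc)

lemma Q_4:
  assumes "A 2 1 = 0" "B 2 1 = 0" "A 2 3 = 1" "B 2 3 = 1" "B 2 2 = 0"
    and "Q A B 3 = [:0, 0, 1:]"
  shows "Q A B 4 = [:0, 0, 0, A 2 2, 1:]"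
  using Q_rec[of 2 A B] assms by (simp add: numeral_eq_Suc)

lemma Q_5:
  assumes "A 3 1 = 0" "B 3 1 = 0" "A 3 4 = 1" "B 3 4 = 1"
    and "Q A B 3 = [:0, 0, 1:]" "Q A B 4 = [:0, 0, 0, a, 1:]"
  shows "Q A B 5 = [:0, A 3 2, A 3 3, a, 1:] * [:0, B 3 2, B 3 3, a, 1:]"
  using Q_rec[of 3 A B] assms by (simp add: numeral_eq_Suc)

context
  fixes m :: nat and A B :: "nat \<Rightarrow> nat \<Rightarrow> complex" and \<alpha> \<beta> :: complex
  assumes m: "3 \<le> m"
    and const_free: "constant_free m A B"
    and normalized: "A 1 2 = 1" "B 1 2 = 1" "B 2 2 = 0"
      "A 2 3 = 1" "A 3 4 = 1" "B 2 3 = 1" "B 3 4 = 1"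
    and cond: "\<alpha> * (B 3 3 - A 3 3) + \<beta> * (B 3 2 - A 3 2) - 2 * \<alpha> * \<beta> - s2 A B \<beta> * A 2 2 = 0"
begin

abbreviation (input) "A' \<equiv> hat_A m A B \<alpha> \<beta>"
abbreviation (input) "B' \<equiv> hat_B m A B \<alpha> \<beta>"

lemma first_column_zero:
  assumes "i \<in> {1, 2, 3}"
  shows "A i 1 = 0" "B i 1 = 0" "A' i 1 = 0" "B' i 1 = 0"
  using assms m const_free by (auto simp: constant_free_def hat_A_def hat_B_def)

lemma Q_hat_3: "Q A B 3 = [:0, 0, 1:]" "Q A' B' 3 = [:0, 0, 1:]"
  \<comment> \<open>The index 1 must not become \<open>Suc 0\<close>, or the normalization facts no
    longer match.\<close>
  by (rule Q_3; simp add: first_column_zero hat_A_def hat_B_def normalized del: One_nat_def)+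

lemma Q_hat_4: "Q A B 4 = [:0, 0, 0, A 2 2, 1:]" "Q A' B' 4 = [:0, 0, 0, A 2 2, 1:]"
proof -
  show "Q A B 4 = [:0, 0, 0, A 2 2, 1:]"
    by (rule Q_4) (simp_all add: first_column_zero normalized Q_hat_3 del: One_nat_def)
  have "Q A' B' 4 = [:0, 0, 0, A' 2 2, 1:]"
    by (rule Q_4) (simp_all add: first_column_zero Q_hat_3 del: One_nat_def,
        simp_all add: hat_A_def hat_B_def normalized)
  then show "Q A' B' 4 = [:0, 0, 0, A 2 2, 1:]"
    by (simp add: hat_A_def)
qed

text \<open>With d = \<alpha>x + \<beta>x^2 the factors F, G of \<open>Q A B 5\<close> become F + d
  and G - d, so the product changes by d(G - F) - d^2. The common tail \<open>Q A B 4\<close>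
  cancels in G - F, which leaves degrees 2 to 4.\<close>

lemma Q_hat_5:
  "Q A' B' 5 = Q A B 5 + smult (s1 A B \<alpha>) (Q A B 3) + smult (s2 A B \<beta>) (Q A B 4)"
proof -
  have 1: "Q A B 5 = [:0, A 3 2, A 3 3, A 2 2, 1:] * [:0, B 3 2, B 3 3, A 2 2, 1:]"
    by (rule Q_5) (simp_all add: first_column_zero normalized Q_hat_3 Q_hat_4 del: One_nat_def)
  have "Q A' B' 5 = [:0, A' 3 2, A' 3 3, A 2 2, 1:] * [:0, B' 3 2, B' 3 3, A 2 2, 1:]"
    by (rule Q_5) (simp_all add: first_column_zero Q_hat_3 Q_hat_4 del: One_nat_def,
        simp_all add: hat_A_def hat_B_def normalized)
  then have 2: "Q A' B' 5 =
      [:0, A 3 2 + \<alpha>, A 3 3 + \<beta>, A 2 2, 1:] * [:0, B 3 2 - \<alpha>, B 3 3 - \<beta>, A 2 2, 1:]"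
    by (simp add: hat_A_def hat_B_def)
  have "s2 A B \<beta> * A 2 2 = \<alpha> * (B 3 3 - A 3 3) + \<beta> * (B 3 2 - A 3 2) - 2 * \<alpha> * \<beta>"
    using cond by (simp add: algebra_simps)
  then show ?thesis
    \<comment> \<open>The first call keeps \<open>s2\<close> folded, so that the x^3 coefficient
      shows the product that the rearranged condition determines.\<close>
    unfolding 1 2 Q_hat_3 Q_hat_4
    by (simp add: s1_def) (simp add: s2_def algebra_simps power2_eq_square)
qed

lemma Q_hat_eq:
  assumes "1 \<le> j" "j \<le> m + 2" "j \<noteq> 5"
  shows "Q A' B' j = Q A B j"
  using assms
proof (induction j rule: less_induct)
  case (less j)
  consider "j = 1" | "j = 2" | "j = 3" | "j = 4" | "6 \<le> j"
    using less.prems by linarith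
  then show ?case
  proof cases
    \<comment> \<open>This is the case \<open>6 \<le> j\<close>: row
      \<open>i = j - 2 \<ge> 4\<close> has corrected weights, and its sums reach index 5.\<close>
    case 5
    then obtain i where i: "j = i + 2" "4 \<le> i" "i \<le> m"
      using less.prems by (intro that[of "j - 2"]) auto
    have IH: "Q A' B' k = Q A B k" if "1 \<le> k" "k \<le> i + 1" "k \<noteq> 5" for k
      using that i less.IH[of k] by simp
    have "(\<Sum>k = 1..i + 1. smult (A' i k) (Q A' B' k)) = (\<Sum>k = 1..i + 1. smult (A i k) (Q A B k))"
      by (rule sum_weights_compensate[OF _ IH Q_hat_5]) (use i in \<open>auto simp: hat_A_def\<close>)
    moreover
    have "(\<Sum>k = 1..i + 1. smult (B' i k) (Q A' B' k)) = (\<Sum>k = 1..i + 1. smult (B i k) (Q A B k))"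
      by (rule sum_weights_compensate[OF _ IH Q_hat_5]) (use i in \<open>auto simp: hat_B_def\<close>)
    ultimately show ?thesis
      using i by (simp add: Q_rec del: One_nat_def add_2_eq_Suc')
  qed (simp_all add: Q_hat_3 Q_hat_4 numeral_2_eq_2)
qed

text \<open>The output is one more compensated combination, of length
  \<open>m + 2 \<ge> 5\<close>.\<close>

lemma assoc_poly_hat: "assoc_poly m A' B' (hat_c A B c \<alpha> \<beta>) = assoc_poly m A B c"
  unfolding assoc_poly_def
  by (rule sum_weights_compensate[OF _ Q_hat_eq Q_hat_5]) (use m in \<open>auto simp: hat_c_def\<close>)

end

theorem theorem3p8:
  fixes m :: nat
    and A B :: "nat \<Rightarrow> nat \<Rightarrow> complex"
    and c :: "nat \<Rightarrow> complex"
    and \<alpha> \<beta> :: complex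
  assumes "3 \<le> m"
    and "triplet m A B c"
    and "constant_free m A B"
    and "A 1 2 = 1" and "B 1 2 = 1"
    and "B 2 2 = 0"
    and "A 2 3 = 1" and "A 3 4 = 1" and "B 2 3 = 1" and "B 3 4 = 1"
    and "\<alpha> * (B 3 3 - A 3 3) + \<beta> * (B 3 2 - A 3 2) - 2 * \<alpha> * \<beta> - s2 A B \<beta> * A 2 2 = 0"
  shows "assoc_poly m (hat_A m A B \<alpha> \<beta>) (hat_B m A B \<alpha> \<beta>) (hat_c A B c \<alpha> \<beta>) = assoc_poly m A B c"
  using assms(1,3-) by (rule assoc_poly_hat)

end
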